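(* Let $A_1,\dots,A_n,C\in\mathcal S^m$ and $b\in\mathbb R^n$, and suppose that both semidefinite programs $$(P\text{-}SDP):\ \inf_{X\in\mathcal S^m}\ C\bullet X\ \text{ s.t. } A_i\bullet X\ge b_i\ (i=1,\dots,n),\ X\succeq0;$$ $$(D\text{-}SDP):\ \sup_{y\in\mathbb R^n}\ b^\top y\ \text{ s.t. } -\sum_{j=1}^n y_jA_j+C\succeq0,\ y\ge0$$ are feasible. Consider the system in $(\bar y,\bar X,\bar t)$: $$A_i\bullet\bar X-b_i\bar t\ge0\ (i=1,\dots,n),\quad -\sum_{j=1}^n\bar y_jA_j+\bar tC\succeq0,\quad b^\top\bar y-C\bullet\bar X\ge0,$$ $$e_n^\top\bar y+\mathrm{tr}(\bar X)+\bar t=1,\quad \bar y\in\mathbb R^n_+,\ \bar X\in\mathcal S^m_+,\ \bar t\ge0.$$ If no solution $(\bar y,\bar X,\bar t)$ of this system satisfies simultaneously $\bar y\ne0$, $\bar X\ne0$, $\bar t=0$ and $b^\top\bar y=C\bullet\bar X$, then at least one of $(P\text{-}SDP)$, $(D\text{-}SDP)$ is strictly feasible. Moreover, $\mathrm{val}(P\text{-}SDP)=\mathrm{val}(D\text{-}SDP)$ and at least one of the sets of optimal solutions $\mathcal S(P\text{-}SDP)$, $\mathcal S(D\text{-}SDP)$ is non-empty, convex and bounded.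
   Context: $\mathcal S^m$ is the space of real symmetric $m\times m$ matrices with Frobenius inner product $B\bullet C=\mathrm{tr}(BC)$; $\mathcal S^m_+$ is the cone of positive semidefinite matrices, and $X\succeq0$ means $X\in\mathcal S^m_+$. $e_n=(1,\dots,1)^\top\in\mathbb R^n$. A program is feasible if its feasible set is non-empty. $(P\text{-}SDP)$ is strictly feasible if there is $X\succeq0$ with $A_i\bullet X>b_i$ for all $i$; $(D\text{-}SDP)$ is strictly feasible if there is $y\ge0$ with $-\sum_j y_jA_j+C$ positive definite. $\mathrm{val}$ denotes the optimal value (infimum, resp. supremum, over the feasible set), and $\mathcal S(\cdot)$ the set of feasible points attaining it. *)

theory Defs
  imports "HOL-Analysis.Analysis"
begin

definition sym_mats :: "(real^'m^'m) set" where
  "sym_mats = {X. transpose X = X}"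

definition psd :: "real^'m^'m \<Rightarrow> bool" where
  "psd X \<longleftrightarrow> X \<in> sym_mats \<and> (\<forall>v. 0 \<le> v \<bullet> (X *v v))"

definition pos_def :: "real^'m^'m \<Rightarrow> bool" where
  "pos_def X \<longleftrightarrow> X \<in> sym_mats \<and> (\<forall>v. v \<noteq> 0 \<longrightarrow> 0 < v \<bullet> (X *v v))"

definition mat_inner :: "real^'m^'m \<Rightarrow> real^'m^'m \<Rightarrow> real"  (infix "\<bullet>\<^sub>F" 70) where
  "B \<bullet>\<^sub>F C = trace (B ** C)"

(* The index types 'm and 'n encode the dimensions m = CARD('m) and n = CARD('n), both at least 1. *)

definition P_feasible :: "('n::finite \<Rightarrow> real^'m^'m) \<Rightarrow> real^'n \<Rightarrow> (real^'m^'m) set" where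
  "P_feasible A b = {X. (\<forall>i. A i \<bullet>\<^sub>F X \<ge> b $ i) \<and> psd X}"

definition D_feasible :: "('n::finite \<Rightarrow> real^'m^'m) \<Rightarrow> real^'m^'m \<Rightarrow> (real^'n) set" where
  "D_feasible A C = {y. psd (- (\<Sum>j\<in>UNIV. y $ j *\<^sub>R A j) + C) \<and> (\<forall>j. 0 \<le> y $ j)}"

definition P_strictly_feasible :: "('n::finite \<Rightarrow> real^'m^'m) \<Rightarrow> real^'n \<Rightarrow> bool" where
  "P_strictly_feasible A b \<longleftrightarrow> (\<exists>X. psd X \<and> (\<forall>i. A i \<bullet>\<^sub>F X > b $ i))"

definition D_strictly_feasible :: "('n::finite \<Rightarrow> real^'m^'m) \<Rightarrow> real^'m^'m \<Rightarrow> bool" where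
  "D_strictly_feasible A C \<longleftrightarrow>
     (\<exists>y. (\<forall>j. 0 \<le> y $ j) \<and> pos_def (- (\<Sum>j\<in>UNIV. y $ j *\<^sub>R A j) + C))"

(* Optimal values live in the extended reals, so that they need no a priori boundedness. *)

definition P_val :: "('n::finite \<Rightarrow> real^'m^'m) \<Rightarrow> real^'n \<Rightarrow> real^'m^'m \<Rightarrow> ereal" where
  "P_val A b C = (INF X\<in>P_feasible A b. ereal (C \<bullet>\<^sub>F X))"

definition D_val :: "('n::finite \<Rightarrow> real^'m^'m) \<Rightarrow> real^'n \<Rightarrow> real^'m^'m \<Rightarrow> ereal" where
  "D_val A b C = (SUP y\<in>D_feasible A C. ereal (b \<bullet> y))"

definition P_solutions ::
    "('n::finite \<Rightarrow> real^'m^'m) \<Rightarrow> real^'n \<Rightarrow> real^'m^'m \<Rightarrow> (real^'m^'m) set" where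
  "P_solutions A b C = {X \<in> P_feasible A b. ereal (C \<bullet>\<^sub>F X) = P_val A b C}"

definition D_solutions ::
    "('n::finite \<Rightarrow> real^'m^'m) \<Rightarrow> real^'n \<Rightarrow> real^'m^'m \<Rightarrow> (real^'n) set" where
  "D_solutions A b C = {y \<in> D_feasible A C. ereal (b \<bullet> y) = D_val A b C}"

definition homogenized_solution ::
    "('n::finite \<Rightarrow> real^'m^'m) \<Rightarrow> real^'n \<Rightarrow> real^'m^'m \<Rightarrow>
     real^'n \<Rightarrow> real^'m^'m \<Rightarrow> real \<Rightarrow> bool" where
  "homogenized_solution A b C y X t \<longleftrightarrow>
     (\<forall>i. A i \<bullet>\<^sub>F X - b $ i * t \<ge> 0) \<and>
     psd (- (\<Sum>j\<in>UNIV. y $ j *\<^sub>R A j) + t *\<^sub>R C) \<and>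
     b \<bullet> y - C \<bullet>\<^sub>F X \<ge> 0 \<and>
     (\<Sum>j\<in>UNIV. y $ j) + trace X + t = 1 \<and>
     (\<forall>j. 0 \<le> y $ j) \<and> psd X \<and> t \<ge> 0"

end

theory Submission
  imports Defs
begin

text \<open>
  A recession direction of the feasible set of the primal program is a positive semidefinite
  \<open>X\<close> with \<open>A i \<bullet> X \<ge> 0\<close> for all \<open>i\<close>, and one of the dual program is a \<open>y \<ge> 0\<close> for which
  \<open>- (\<Sum>j. y $ j *\<^sub>R A j)\<close> is positive semidefinite. Pairing such directions with a feasible point
  of the opposite program gives \<open>C \<bullet> X \<ge> 0\<close> and \<open>b \<bullet> y \<le> 0\<close>. If there were nonzero directions
  with \<open>C \<bullet> X \<le> 0\<close> and \<open>b \<bullet> y \<ge> 0\<close>, both values would vanish, and the pair, scaled to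
  satisfy the normalisation, would be an excluded solution of the homogenised system with
  \<open>t = 0\<close> (lemma \<open>recession_pair\<close>). So one of the two programs has no nonzero recession direction
  along which its objective does not get worse.

  By separation of convex sets, this absence makes the \<^emph>\<open>other\<close> program strictly feasible
  (lemma \<open>strictly_feasible\<close>). Slater's condition then yields equality of the values
  and attainment (lemma \<open>dual_attains_lower_bound\<close>), and it bounds the level sets of the
  program without such directions (lemma \<open>bounded_dual_level\<close>), in particular its solution set.

  The two cases are instances of a single theory of conic programs: \<open>x \<in> K\<close>, \<open>f x - b \<in> L\<close>,
  with \<open>K\<close> the semidefinite cone and \<open>L\<close> the orthant in one case, and \<open>K\<close> the orthant and
  \<open>L\<close> the dual of the semidefinite cone in the other. The link is that the dual of the
  semidefinite cone meets the symmetric matrices in the semidefinite cone, which rests on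
  the nonnegativity of the inner product of two positive semidefinite matrices.
\<close>

section \<open>Dual cones and conic programs\<close>

text \<open>The dual cone consists of the vectors that are nonnegative on the whole of \<open>K\<close>.\<close>
definition dual_cone :: "'a::euclidean_space set \<Rightarrow> 'a set" where
  "dual_cone K = {z. \<forall>x\<in>K. 0 \<le> z \<bullet> x}"

lemma convex_cone_dual_cone: "convex_cone (dual_cone K)"
  by (auto simp: convex_cone_iff dual_cone_def inner_add_left)

text \<open>
  Unless the dual cone is trivial, the constant is the minimum of \<open>y \<bullet> z\<close> over the compact set of
  its unit vectors.
\<close>
lemma dual_cone_pos_lower_bound:
  fixes L :: "'a::euclidean_space set"
  assumes "\<forall>y\<in>dual_cone L. y \<noteq> 0 \<longrightarrow> 0 < y \<bullet> z"
  shows "\<exists>\<delta>>0. \<forall>y\<in>dual_cone L. \<delta> * norm y \<le> y \<bullet> z"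
proof -
  let ?B = "dual_cone L \<inter> sphere 0 1"
  have "closed (dual_cone L)"
  proof -
    have "dual_cone L = (\<Inter>x\<in>L. {y. x \<bullet> y \<ge> 0})"
      by (auto simp: dual_cone_def inner_commute)
    then show ?thesis by (auto intro: closed_halfspace_ge)
  qed
  then have cpt: "compact ?B" by (intro closed_Int_compact) auto
  show ?thesis
  proof (cases "?B = {}")
    case True
    have "y = 0" if "y \<in> dual_cone L" for y
    proof (rule ccontr)
      assume "y \<noteq> 0"
      then have "(1 / norm y) *\<^sub>R y \<in> ?B"
        using convex_cone_scaleR[OF convex_cone_dual_cone _ that, of "1 / norm y"] by auto
      with True show False by auto
    qed
    then have "\<forall>y\<in>dual_cone L. 1 * norm y \<le> y \<bullet> z" by fastforce
    then show ?thesis by (intro exI[of _ 1]) simp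
  next
    case False
    have "continuous_on ?B (\<lambda>y. y \<bullet> z)" by (intro continuous_intros)
    from continuous_attains_inf[OF cpt False this]
    obtain w where w: "w \<in> ?B" "\<forall>y\<in>?B. w \<bullet> z \<le> y \<bullet> z" by blast
    have pos: "0 < w \<bullet> z" using w(1) assms by auto
    have "(w \<bullet> z) * norm y \<le> y \<bullet> z" if "y \<in> dual_cone L" for y
    proof (cases "y = 0")
      case False
      then have "(1 / norm y) *\<^sub>R y \<in> ?B"
        using convex_cone_scaleR[OF convex_cone_dual_cone _ that, of "1 / norm y"] by auto
      with w(2) have "w \<bullet> z \<le> ((1 / norm y) *\<^sub>R y) \<bullet> z" by blast
      with False show ?thesis by (simp add: field_simps)
    qed auto
    with pos show ?thesis by blast
  qed
qed

lemma linear_bounded_below_on_cone_nonneg: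
  fixes g :: "'a::real_vector \<Rightarrow> real"
  assumes K: "convex_cone K" and g: "linear g" and r: "\<forall>x\<in>K. r \<le> g x" and x: "x \<in> K"
  shows "0 \<le> g x"
proof (rule ccontr)
  assume "\<not> 0 \<le> g x"
  then have neg: "g x < 0" by simp
  define s where "s = (\<bar>r\<bar> + 1) / - g x"
  have "0 \<le> s" using neg unfolding s_def by (intro divide_nonneg_pos) auto
  then have "s *\<^sub>R x \<in> K" using x by (rule convex_cone_scaleR[OF K])
  then have "r \<le> s * g x" using r g by (metis linear_scale real_scaleR_def)
  moreover have "s * g x = - (\<bar>r\<bar> + 1)" using neg by (simp add: s_def)
  ultimately show False by linarith
qed

text \<open>
  The conic program: minimise \<open>c \<bullet> x\<close> over \<open>x \<in> K\<close> with \<open>f x - b \<in> L\<close>. The point \<open>e\<close> is positive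
  on all nonzero elements of the dual cone of \<open>L\<close>; it plays the role of an interior point of \<open>L\<close>.
\<close>
locale conic_program =
  fixes K :: "'a::euclidean_space set" and L :: "'b::euclidean_space set"
    and f :: "'a \<Rightarrow> 'b" and c :: 'a and b e :: 'b
  assumes K: "convex_cone K" and L: "convex_cone L" and lin: "linear f"
    and e: "\<forall>y\<in>dual_cone L. y \<noteq> 0 \<longrightarrow> 0 < y \<bullet> e"
begin

definition primal :: "'a set" where
  "primal = {x\<in>K. f x - b \<in> L}"

text \<open>
  The dual program maximises \<open>b \<bullet> y\<close>. The condition that \<open>c\<close> minus the adjoint of \<open>f\<close> at \<open>y\<close> lies
  in the dual cone of \<open>K\<close> is written out on \<open>K\<close>, so that no adjoint map is needed.
\<close>
definition dual :: "'b set" where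
  "dual = {y\<in>dual_cone L. \<forall>x\<in>K. f x \<bullet> y \<le> c \<bullet> x}"

text \<open>
  The vectors that are positive on all nonzero elements of the dual cone of \<open>L\<close>. They replace
  the interior of \<open>L\<close> in the formulation of strict feasibility.
\<close>
definition strict :: "'b set" where
  "strict = {z. \<forall>y\<in>dual_cone L. y \<noteq> 0 \<longrightarrow> 0 < y \<bullet> z}"

lemma weak_duality: "x \<in> primal \<Longrightarrow> y \<in> dual \<Longrightarrow> b \<bullet> y \<le> c \<bullet> x"
  unfolding primal_def dual_def dual_cone_def
  by (fastforce simp: inner_diff_right inner_commute)

text \<open>
  If no point of \<open>K\<close> is strictly feasible, a hyperplane separates the vectors \<open>f x - b\<close>, \<open>x \<in> K\<close>,
  from \<open>strict\<close>; its normal is a nonzero recession direction \<open>a\<close> of the dual program with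
  \<open>b \<bullet> a \<ge> 0\<close>.
\<close>
lemma strictly_feasible:
  assumes reg: "\<forall>y\<in>dual_cone L. y \<noteq> 0 \<longrightarrow> (\<forall>x\<in>K. f x \<bullet> y \<le> 0) \<longrightarrow> b \<bullet> y < 0"
  shows "\<exists>x\<in>K. f x - b \<in> strict"
proof (rule ccontr)
  assume none: "\<not> (\<exists>x\<in>K. f x - b \<in> strict)"
  let ?S = "(\<lambda>x. f x - b) ` K"
  have K0: "0 \<in> K" by (rule convex_cone_contains_0[OF K])
  have convS: "convex ?S"
  proof -
    have "convex ((\<lambda>x. - b + x) ` (f ` K))"
      using K lin by (intro convex_translation convex_linear_image) (auto simp: convex_cone_def)
    then show ?thesis by (simp add: image_image)
  qed
  have e_shift: "l + \<epsilon> *\<^sub>R e \<in> strict" if "l \<in> L" "0 < \<epsilon>" for l and \<epsilon> :: real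
    using that e by (auto simp: strict_def dual_cone_def inner_add_right intro!: add_nonneg_pos)
  have convT: "convex strict"
  proof -
    have "strict = (\<Inter>y\<in>dual_cone L - {0}. {z. y \<bullet> z > 0})"
      by (auto simp: strict_def)
    then show ?thesis by (auto intro!: convex_INT convex_halfspace_gt)
  qed
  have "strict \<noteq> {}" using e by (auto simp: strict_def)
  then obtain a \<beta> where a: "a \<noteq> 0" and S: "\<forall>x\<in>K. a \<bullet> (f x - b) \<le> \<beta>"
    and T: "\<forall>z\<in>strict. \<beta> \<le> a \<bullet> z"
  proof -
    have "?S \<noteq> {}" "?S \<inter> strict = {}" using K0 none by auto
    from separating_hyperplane_sets[OF convS convT this(1) \<open>strict \<noteq> {}\<close> this(2)]
    show thesis using that by auto
  qed
  have lower: "\<beta> \<le> a \<bullet> l + \<epsilon> * (a \<bullet> e)" if "l \<in> L" "0 < \<epsilon>" for l \<epsilon>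
    using bspec[OF T e_shift[OF that]] by (simp add: inner_add_right)
  (* strict approaches every point of L along e *)
  have lower': "\<beta> \<le> a \<bullet> l" if "l \<in> L" for l
  proof (rule field_le_epsilon)
    fix \<epsilon> :: real assume "0 < \<epsilon>"
    define \<eta> where "\<eta> = \<epsilon> / (\<bar>a \<bullet> e\<bar> + 1)"
    have "0 < \<eta>" using \<open>0 < \<epsilon>\<close> by (simp add: \<eta>_def)
    have "\<eta> * (a \<bullet> e) \<le> \<epsilon>"
    proof -
      have "\<eta> * (a \<bullet> e) \<le> \<eta> * (\<bar>a \<bullet> e\<bar> + 1)"
        using \<open>0 < \<eta>\<close> by (intro mult_left_mono) auto
      also have "\<dots> = \<epsilon>" by (simp add: \<eta>_def)
      finally show ?thesis .
    qed
    with lower[OF that \<open>0 < \<eta>\<close>] show "\<beta> \<le> a \<bullet> l + \<epsilon>" by linarith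
  qed
  have \<beta>: "\<beta> \<le> 0" using lower'[OF convex_cone_contains_0[OF L]] by simp
  have aL: "a \<in> dual_cone L"
    using linear_bounded_below_on_cone_nonneg[OF L, of "\<lambda>l. a \<bullet> l" \<beta>] lower'
    by (auto simp: dual_cone_def bounded_linear.linear[OF bounded_linear_inner_right])
  have S': "- (a \<bullet> b) \<le> - (a \<bullet> f x)" if "x \<in> K" for x
    using bspec[OF S that] \<beta> by (simp add: inner_diff_right)
  have "linear (\<lambda>x. - (a \<bullet> f x))"
    by (rule linearI) (simp_all add: linear_add[OF lin] linear_scale[OF lin] inner_add_right)
  then have "\<forall>x\<in>K. 0 \<le> - (a \<bullet> f x)"
    using linear_bounded_below_on_cone_nonneg[OF K] S' by blast
  then have "\<forall>x\<in>K. f x \<bullet> a \<le> 0" by (simp add: inner_commute)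
  with reg aL a have "b \<bullet> a < 0" by blast
  moreover have "0 \<le> a \<bullet> b" using S'[OF K0] by (simp add: linear_0[OF lin])
  ultimately show False by (simp add: inner_commute)
qed


text \<open>
  The vectors \<open>(f x - b, c \<bullet> x)\<close>, \<open>x \<in> K\<close>, avoid \<open>L \<times> {..<\<mu>}\<close>. The normal of a separating
  hyperplane is \<open>(- a, \<rho>)\<close> with \<open>a\<close> in the dual cone of \<open>L\<close> and \<open>\<rho> \<ge> 0\<close>; the strictly feasible
  point excludes \<open>\<rho> = 0\<close>, and \<open>a / \<rho>\<close> is the required dual point.
\<close>
lemma dual_attains_lower_bound:
  assumes x0: "x0 \<in> K" "f x0 - b \<in> strict" and \<mu>: "\<forall>x\<in>primal. \<mu> \<le> c \<bullet> x"
  shows "\<exists>y\<in>dual. \<mu> \<le> b \<bullet> y"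
proof -
  let ?S = "(\<lambda>x. (f x - b, c \<bullet> x)) ` K" and ?T = "L \<times> {..<\<mu>}"
  have K0: "0 \<in> K" and L0: "0 \<in> L" using K L by (auto intro: convex_cone_contains_0)
  have "convex ?S"
  proof -
    have "linear (\<lambda>x. (f x, c \<bullet> x))"
      by (rule linearI) (simp_all add: linear_add[OF lin] linear_scale[OF lin] inner_add_right)
    then have "convex ((\<lambda>p. (- b, 0) + p) ` ((\<lambda>x. (f x, c \<bullet> x)) ` K))"
      using K by (intro convex_translation convex_linear_image) (auto simp: convex_cone_def)
    then show ?thesis by (simp add: image_image)
  qed
  moreover have "convex ?T"
    using L by (intro convex_Times) (auto simp: convex_cone_def)
  moreover have "?S \<inter> ?T = {}"
    using \<mu> by (auto simp: primal_def)
  moreover have "?T \<noteq> {}" using L0 lt_ex by auto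
  moreover have "?S \<noteq> {}" using K0 by auto
  ultimately obtain p \<beta> where p: "p \<noteq> 0" "\<forall>q\<in>?T. p \<bullet> q \<le> \<beta>" "\<forall>q\<in>?S. \<beta> \<le> p \<bullet> q"
    using separating_hyperplane_sets[of ?T ?S] by blast
  obtain a \<rho> where ap: "p = (- a, \<rho>)" by (metis minus_minus surj_pair)
  have S: "\<beta> \<le> \<rho> * (c \<bullet> x) - a \<bullet> (f x - b)" if "x \<in> K" for x
    using p(3) that by (auto simp: ap)
  have T: "\<rho> * r - a \<bullet> l \<le> \<beta>" if "l \<in> L" "r < \<mu>" for l r
    using p(2) that by (auto simp: ap)
  have \<rho>0: "0 \<le> \<rho>"
  proof (rule ccontr)
    assume "\<not> 0 \<le> \<rho>"
    then have neg: "\<rho> < 0" by simp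
    define r where "r = min (\<mu> - 1) ((\<beta> + 1) / \<rho>)"
    have "\<rho> * r \<le> \<beta>" using T[OF L0, of r] by (simp add: r_def)
    moreover have "r \<le> (\<beta> + 1) / \<rho>" by (simp add: r_def)
    then have "\<beta> + 1 \<le> \<rho> * r" using neg by (simp add: neg_le_divide_eq mult.commute)
    ultimately show False by simp
  qed
  have aL: "a \<in> dual_cone L"
    using linear_bounded_below_on_cone_nonneg[OF L, of "\<lambda>l. a \<bullet> l" "\<rho> * (\<mu> - 1) - \<beta>"]
      T[of _ "\<mu> - 1"]
    by (fastforce simp: dual_cone_def bounded_linear.linear[OF bounded_linear_inner_right])
  have \<beta>: "\<rho> * \<mu> \<le> \<beta>"
  proof (rule field_le_epsilon)
    fix \<epsilon> :: real assume "0 < \<epsilon>"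
    define \<eta> where "\<eta> = \<epsilon> / (\<rho> + 1)"
    have "0 < \<eta>" using \<open>0 < \<epsilon>\<close> \<rho>0 by (simp add: \<eta>_def)
    then have "\<rho> * (\<mu> - \<eta>) \<le> \<beta>" using T[OF L0, of "\<mu> - \<eta>"] by simp
    moreover have "\<rho> * \<eta> \<le> (\<rho> + 1) * \<eta>" using \<open>0 < \<eta>\<close> by simp
    moreover have "(\<rho> + 1) * \<eta> = \<epsilon>" using \<rho>0 by (simp add: \<eta>_def)
    ultimately show "\<rho> * \<mu> \<le> \<beta> + \<epsilon>" by (simp add: algebra_simps)
  qed
  have "\<rho> \<noteq> 0"
  proof
    assume "\<rho> = 0"
    with p(1) ap have "a \<noteq> 0" by (auto simp: zero_prod_def)
    then have "0 < a \<bullet> (f x0 - b)" using x0(2) aL by (auto simp: strict_def)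
    with S[OF x0(1)] \<beta> \<open>\<rho> = 0\<close> show False by simp
  qed
  with \<rho>0 have \<rho>: "0 < \<rho>" by simp
  define y where "y = (1 / \<rho>) *\<^sub>R a"
  have yL: "y \<in> dual_cone L"
    unfolding y_def using \<rho> aL by (intro convex_cone_scaleR[OF convex_cone_dual_cone]) auto
  have S': "\<mu> - b \<bullet> y \<le> c \<bullet> x - f x \<bullet> y" if "x \<in> K" for x
  proof -
    have "\<rho> * \<mu> \<le> \<rho> * (c \<bullet> x) - a \<bullet> (f x - b)" using S[OF that] \<beta> by simp
    also have "a = \<rho> *\<^sub>R y" using \<rho> by (simp add: y_def)
    also have "\<rho> * (c \<bullet> x) - (\<rho> *\<^sub>R y) \<bullet> (f x - b) = \<rho> * (c \<bullet> x - f x \<bullet> y + b \<bullet> y)"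
      by (simp add: inner_commute algebra_simps)
    finally show ?thesis using \<rho> by simp
  qed
  have "linear (\<lambda>x. c \<bullet> x - f x \<bullet> y)"
    by (rule linearI)
      (simp_all add: linear_add[OF lin] linear_scale[OF lin] algebra_simps)
  then have "0 \<le> c \<bullet> x - f x \<bullet> y" if "x \<in> K" for x
    using linear_bounded_below_on_cone_nonneg[OF K] S' that by blast
  then have "y \<in> dual" using yL by (simp add: dual_def)
  moreover have "\<mu> \<le> b \<bullet> y" using S'[OF K0] by (simp add: linear_0[OF lin])
  ultimately show ?thesis by blast
qed

lemma convex_dual: "convex dual"
proof -
  have "dual = dual_cone L \<inter> (\<Inter>x\<in>K. {y. f x \<bullet> y \<le> c \<bullet> x})"
    by (auto simp: dual_def)
  then show ?thesis
    using convex_cone_dual_cone[of L]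
    by (auto simp: convex_cone_def intro!: convex_Int convex_INT convex_halfspace_le)
qed

text \<open>
  For dual feasible \<open>y\<close>, \<open>y \<bullet> (f x0 - b) \<le> c \<bullet> x0 - b \<bullet> y\<close>, and the left side dominates a
  positive multiple of \<open>norm y\<close>.
\<close>
lemma bounded_dual_level:
  assumes x0: "x0 \<in> K" "f x0 - b \<in> strict"
  shows "bounded {y\<in>dual. v \<le> b \<bullet> y}"
proof -
  obtain \<delta> where \<delta>: "0 < \<delta>" "\<forall>y\<in>dual_cone L. \<delta> * norm y \<le> y \<bullet> (f x0 - b)"
    using dual_cone_pos_lower_bound[of L "f x0 - b"] x0(2) by (auto simp: strict_def)
  have "norm y \<le> (c \<bullet> x0 - v) / \<delta>" if y: "y \<in> dual" and v: "v \<le> b \<bullet> y" for y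
  proof -
    have "\<delta> * norm y \<le> y \<bullet> (f x0 - b)" using \<delta>(2) y by (auto simp: dual_def)
    also have "\<dots> = f x0 \<bullet> y - b \<bullet> y" by (simp add: inner_diff_right inner_commute)
    also have "\<dots> \<le> c \<bullet> x0 - v" using y v x0(1) by (auto simp: dual_def intro: diff_mono)
    finally show ?thesis using \<delta>(1) by (simp add: field_simps)
  qed
  then show ?thesis by (auto simp: bounded_iff)
qed

theorem strong_duality:
  assumes ne: "primal \<noteq> {}" "dual \<noteq> {}" and x0: "x0 \<in> K" "f x0 - b \<in> strict"
  defines "D \<equiv> (SUP y\<in>dual. ereal (b \<bullet> y))"
  defines "S \<equiv> {y\<in>dual. ereal (b \<bullet> y) = D}"
  shows "(INF x\<in>primal. ereal (c \<bullet> x)) = D" and "S \<noteq> {}" and "convex S" and "bounded S"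
proof -
  obtain x1 y1 where 1: "x1 \<in> primal" "y1 \<in> dual" using ne by blast
  let ?P = "INF x\<in>primal. ereal (c \<bullet> x)"
  have "ereal (b \<bullet> y1) \<le> ?P" using weak_duality 1 by (auto intro!: INF_greatest)
  moreover have "?P \<le> ereal (c \<bullet> x1)" using 1 by (auto intro: INF_lower)
  ultimately obtain \<mu> where \<mu>: "?P = ereal \<mu>" by (cases ?P) auto
  have "\<mu> \<le> c \<bullet> x" if "x \<in> primal" for x
    using INF_lower[OF that, of "\<lambda>x. ereal (c \<bullet> x)"] \<mu> by simp
  then obtain y where y: "y \<in> dual" "\<mu> \<le> b \<bullet> y" using dual_attains_lower_bound[OF x0] by blast
  have "ereal (b \<bullet> y) \<le> D" unfolding D_def using y by (auto intro: SUP_upper)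
  moreover have "D \<le> ?P"
    unfolding D_def using weak_duality by (auto intro!: SUP_least INF_greatest)
  ultimately have D: "D = ereal \<mu>" and "b \<bullet> y = \<mu>" using y \<mu> by (cases D; simp)+
  then show "S \<noteq> {}" "?P = D" using y \<mu> by (auto simp: S_def)
  have "S = dual \<inter> {y. b \<bullet> y = \<mu>}" by (auto simp: S_def D)
  then show "convex S" by (auto intro: convex_Int convex_dual convex_hyperplane)
  show "bounded S"
    using bounded_dual_level[OF x0, of \<mu>] by (rule bounded_subset) (auto simp: S_def D)
qed

end

section \<open>The cone of positive semidefinite matrices\<close>

text \<open>The rank-one matrix formed by \<open>u\<close> times its transpose.\<close>
definition outer :: "real^'m \<Rightarrow> real^'m^'m" where
  "outer u = (\<chi> i j. u $ i * u $ j)"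

lemma outer_mult_vector: "outer u *v v = (u \<bullet> v) *\<^sub>R u"
  by (simp add: vec_eq_iff outer_def matrix_vector_mult_def inner_vec_def sum_distrib_left mult_ac)

lemma inner_outer: "M \<bullet> outer u = u \<bullet> (M *v u)"
  by (simp add: inner_vec_def outer_def matrix_vector_mult_def sum_distrib_left mult_ac)

lemma transpose_outer: "transpose (outer u) = outer u"
  by (simp add: vec_eq_iff outer_def transpose_def mult.commute)

lemma inner_transpose: "transpose M \<bullet> (X :: real^'m^'m) = M \<bullet> transpose X"
  unfolding inner_vec_def transpose_def by (simp, rule sum.swap)

lemma subspace_sym_mats: "subspace (sym_mats :: (real^'m^'m) set)"
  by (auto simp: subspace_def sym_mats_def vec_eq_iff transpose_def)

lemma sym_mats_mult_inner:
  assumes "X \<in> sym_mats"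
  shows "(X *v v) \<bullet> w = v \<bullet> (X *v w)"
proof -
  have "X *v v = v v* X"
    using assms transpose_matrix_vector[of X v] by (simp add: sym_mats_def)
  then show ?thesis by (simp add: dot_lmul_matrix)
qed

lemma mat_inner_eq_inner:
  assumes "B \<in> sym_mats"
  shows "B \<bullet>\<^sub>F X = B \<bullet> X"
proof -
  have "transpose B \<bullet>\<^sub>F X = B \<bullet> X"
    unfolding mat_inner_def trace_def matrix_matrix_mult_def transpose_def inner_vec_def
    by (simp, rule sum.swap)
  with assms show ?thesis by (simp add: sym_mats_def)
qed

lemma trace_eq_inner: "trace X = mat 1 \<bullet> (X :: real^'m^'m)"
  using mat_inner_eq_inner[of "mat 1" X] by (simp add: mat_inner_def sym_mats_def)

lemma psd_outer: "psd (outer u)"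
  by (auto simp: psd_def sym_mats_def transpose_outer outer_mult_vector inner_commute)

lemma quadratic_form_add:
  fixes X :: "real^'m^'m"
  assumes "X \<in> sym_mats"
  shows "(v + s *\<^sub>R w) \<bullet> (X *v (v + s *\<^sub>R w))
    = v \<bullet> (X *v v) + 2 * s * (w \<bullet> (X *v v)) + s\<^sup>2 * (w \<bullet> (X *v w))"
proof -
  have "v \<bullet> (X *v w) = w \<bullet> (X *v v)"
    using sym_mats_mult_inner[OF assms, of v w] by (simp add: inner_commute)
  then show ?thesis
    by (simp add: matrix_vector_mult_scaleR power2_eq_square algebra_simps)
qed

text \<open>
  One step of a Cholesky-type decomposition: for \<open>w\<close> with \<open>q = w \<bullet> (X *v w) > 0\<close>, subtracting
  \<open>outer (X *v w)\<close> divided by \<open>q\<close> keeps the matrix positive semidefinite and adds \<open>w\<close> to its kernel.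
\<close>
lemma psd_deflate:
  fixes X :: "real^'m^'m"
  assumes X: "psd X" and "X \<noteq> 0"
  obtains u Y where "u \<noteq> 0" "psd Y" "X = Y + outer u"
    "{v. X *v v = 0} \<subset> {v. Y *v v = 0}"
proof -
  have sym: "X \<in> sym_mats" and nn: "\<And>v. 0 \<le> v \<bullet> (X *v v)" using X by (auto simp: psd_def)
  obtain w where "w \<bullet> (X *v w) \<noteq> 0"
  proof (rule ccontr)
    assume "\<not> thesis"
    then have *: "w \<bullet> (X *v w) = 0" for w using that by blast
    have "X *v v = 0" for v
      using quadratic_form_add[OF sym, of v 1 "X *v v"] * by simp
    then have "X = 0" by (simp add: matrix_eq)
    with \<open>X \<noteq> 0\<close> show False ..
  qed
  define q where "q = w \<bullet> (X *v w)"
  have q: "0 < q" using nn[of w] \<open>w \<bullet> (X *v w) \<noteq> 0\<close> by (simp add: q_def)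
  define u where "u = (1 / sqrt q) *\<^sub>R (X *v w)"
  define Y where "Y = X - outer u"
  have Yv: "Y *v v = X *v v - ((w \<bullet> (X *v v)) / q) *\<^sub>R (X *v w)" for v
    using q sym_mats_mult_inner[OF sym, of w v]
    by (simp add: Y_def matrix_vector_mult_diff_rdistrib outer_mult_vector u_def)
  show thesis
  proof
    show "u \<noteq> 0" using q by (auto simp: u_def q_def)
    show "X = Y + outer u" by (simp add: Y_def)
    show "psd Y"
      unfolding psd_def
    proof (intro conjI allI)
      show "Y \<in> sym_mats"
        using sym subspace_diff[OF subspace_sym_mats] transpose_outer
        by (auto simp: Y_def sym_mats_def)
      fix v
      (* s minimises the quadratic form along the line v + s w *)
      define s where "s = - ((w \<bullet> (X *v v)) / q)"
      have "v \<bullet> (X *v w) = w \<bullet> (X *v v)"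
        using sym_mats_mult_inner[OF sym, of v w] by (simp add: inner_commute)
      then have "v \<bullet> (Y *v v) = v \<bullet> (X *v v) - (w \<bullet> (X *v v))\<^sup>2 / q"
        by (simp add: Yv inner_diff_right power2_eq_square)
      also have "\<dots> = (v + s *\<^sub>R w) \<bullet> (X *v (v + s *\<^sub>R w))"
        unfolding quadratic_form_add[OF sym] using q
        by (simp add: s_def q_def[symmetric] power2_eq_square field_simps)
      finally show "0 \<le> v \<bullet> (Y *v v)" using nn by simp
    qed
    have "w \<in> {v. Y *v v = 0}" using q by (simp add: Yv q_def[symmetric])
    moreover have "w \<notin> {v. X *v v = 0}" using q by (auto simp: q_def)
    moreover have "{v. X *v v = 0} \<subseteq> {v. Y *v v = 0}" by (auto simp: Yv)
    ultimately show "{v. X *v v = 0} \<subset> {v. Y *v v = 0}" by blast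
  qed
qed

text \<open>
  Deflating \<open>X\<close> repeatedly writes it as a sum of matrices \<open>outer u\<close>, whose inner products with \<open>M\<close>
  are the values \<open>u \<bullet> (M *v u)\<close>; the induction is on the codimension of the kernel of \<open>X\<close>.
\<close>
lemma inner_psd_nonneg:
  fixes X M :: "real^'m^'m"
  assumes "psd X" and M: "\<forall>v. 0 \<le> v \<bullet> (M *v v)"
  shows "0 \<le> M \<bullet> X"
  using \<open>psd X\<close>
proof (induction "CARD('m) - dim {v. X *v v = 0}" arbitrary: X rule: less_induct)
  case less
  show ?case
  proof (cases "X = 0")
    case False
    then obtain u Y where uY: "psd Y" "X = Y + outer u"
      and ker: "{v. X *v v = 0} \<subset> {v. Y *v v = 0}"
      using psd_deflate[OF less.prems] by metis
    have sub: "subspace {v. Z *v v = 0}" for Z :: "real^'m^'m"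
      by (auto simp: subspace_def matrix_vector_right_distrib matrix_vector_mult_scaleR)
    have "dim {v. X *v v = 0} < dim {v. Y *v v = 0}"
      using ker sub by (intro dim_psubset) (simp add: span_eq_iff[THEN iffD2])
    moreover have "dim {v. Y *v v = 0} \<le> CARD('m)"
      using dim_subset_UNIV[of "{v. Y *v v = 0}"] by simp
    ultimately have "CARD('m) - dim {v. Y *v v = 0} < CARD('m) - dim {v. X *v v = 0}"
      by linarith
    then have "0 \<le> M \<bullet> Y" using less.hyps uY(1) by blast
    then show ?thesis using M by (simp add: uY(2) inner_add_right inner_outer)
  qed auto
qed

lemma trace_psd_pos:
  assumes "psd X" and "X \<noteq> 0"
  shows "0 < trace X"
proof -
  obtain u Y where "u \<noteq> 0" "psd Y" and X: "X = Y + outer u"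
    using psd_deflate[OF assms] by metis
  then have "0 \<le> mat 1 \<bullet> Y" by (intro inner_psd_nonneg) auto
  then show ?thesis
    using \<open>u \<noteq> 0\<close> by (simp add: X trace_eq_inner inner_add_right inner_outer add_nonneg_pos)
qed

lemma convex_cone_psd: "convex_cone {X :: real^'m^'m. psd X}"
  using subspace_sym_mats
  by (auto simp: convex_cone_iff psd_def subspace_def matrix_vector_mult_add_rdistrib
      scaleR_matrix_vector_assoc[symmetric] inner_add_right)

text \<open>
  Symmetry has to be assumed: in the space of all square matrices, the dual of the semidefinite cone
  also contains all antisymmetric matrices.
\<close>
lemma dual_cone_psd_iff:
  assumes "M \<in> sym_mats"
  shows "M \<in> dual_cone {X. psd X} \<longleftrightarrow> psd M"
proof
  assume "M \<in> dual_cone {X. psd X}"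
  then have "0 \<le> M \<bullet> outer v" for v using psd_outer by (auto simp: dual_cone_def)
  with assms show "psd M" by (simp add: psd_def inner_outer)
qed (auto simp: dual_cone_def psd_def intro: inner_psd_nonneg)

lemma dual_cone_dual_cone_psd: "dual_cone (dual_cone {X :: real^'m^'m. psd X}) = {X. psd X}"
proof
  show "{X :: real^'m^'m. psd X} \<subseteq> dual_cone (dual_cone {X. psd X})"
    by (auto simp: dual_cone_def inner_commute)
  show "dual_cone (dual_cone {X :: real^'m^'m. psd X}) \<subseteq> {X. psd X}"
  proof
    fix X :: "real^'m^'m" assume X: "X \<in> dual_cone (dual_cone {X. psd X})"
    (* the antisymmetric matrix transpose X - X lies in the dual cone, which forces it to vanish *)
    let ?M = "transpose X - X"
    have "?M \<bullet> Y = 0" if "psd Y" for Y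
      using that inner_transpose[of X Y] by (auto simp: psd_def sym_mats_def inner_diff_left)
    then have "?M \<in> dual_cone {X. psd X}" by (simp add: dual_cone_def)
    with X have "0 \<le> X \<bullet> ?M" by (auto simp: dual_cone_def)
    moreover have "?M \<bullet> ?M = - 2 * (X \<bullet> ?M)"
      using inner_transpose[of X "transpose X"]
      by (simp add: algebra_simps inner_commute)
    ultimately have "?M \<bullet> ?M \<le> 0" by simp
    then have "?M = 0" by (metis inner_eq_zero_iff inner_ge_zero order_antisym)
    then have "X \<in> sym_mats" by (simp add: sym_mats_def)
    moreover have "0 \<le> v \<bullet> (X *v v)" for v
    proof -
      have "outer v \<in> dual_cone {X. psd X}"
        by (subst dual_cone_psd_iff) (auto simp: psd_outer sym_mats_def transpose_outer)
      with X have "0 \<le> X \<bullet> outer v" by (auto simp: dual_cone_def)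
      then show ?thesis by (simp add: inner_outer)
    qed
    ultimately show "X \<in> {X. psd X}" by (simp add: psd_def)
  qed
qed

lemma inner_real_vec: "x \<bullet> y = (\<Sum>j\<in>UNIV. x $ j * (y :: real^'n) $ j)"
  by (simp add: inner_vec_def)

lemma convex_cone_orthant: "convex_cone {y :: real^'n. \<forall>j. 0 \<le> y $ j}"
  by (auto simp: convex_cone_iff)

lemma dual_cone_orthant: "dual_cone {y :: real^'n. \<forall>j. 0 \<le> y $ j} = {y. \<forall>j. 0 \<le> y $ j}"
proof
  show "dual_cone {y :: real^'n. \<forall>j. 0 \<le> y $ j} \<subseteq> {y. \<forall>j. 0 \<le> y $ j}"
  proof (intro subsetI CollectI allI)
    fix y :: "real^'n" and j assume y: "y \<in> dual_cone {y. \<forall>j. 0 \<le> y $ j}"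
    have "axis j 1 \<in> {y :: real^'n. \<forall>j. 0 \<le> y $ j}" by (simp add: axis_def)
    with y have "0 \<le> y \<bullet> axis j 1" unfolding dual_cone_def by blast
    then show "0 \<le> y $ j" by (simp add: inner_axis)
  qed
qed (auto simp: dual_cone_def inner_vec_def intro!: sum_nonneg)

lemma orthant_sum_pos:
  fixes y :: "real^'n"
  assumes "\<forall>j. 0 \<le> y $ j" and "y \<noteq> 0"
  shows "0 < (\<Sum>j\<in>UNIV. y $ j)"
proof -
  obtain j where "y $ j \<noteq> 0" using \<open>y \<noteq> 0\<close> by (auto simp: vec_eq_iff)
  then show ?thesis
    using assms(1) by (intro sum_pos2[of _ j]) (auto simp: less_le)
qed

section \<open>The two semidefinite programs\<close>

locale semidefinite_program =
  fixes A :: "'n::finite \<Rightarrow> real^'m^'m" and C :: "real^'m^'m" and b :: "real^'n"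
  assumes A_sym: "A i \<in> sym_mats" and C_sym: "C \<in> sym_mats"
begin

text \<open>The adjoint of the constraint map that sends \<open>X\<close> to the vector of the \<open>A i \<bullet> X\<close>.\<close>
definition comb :: "real^'n \<Rightarrow> real^'m^'m" where
  "comb y = (\<Sum>j\<in>UNIV. y $ j *\<^sub>R A j)"

lemma comb_sym: "comb y \<in> sym_mats"
  unfolding comb_def
  by (intro subspace_sum[OF subspace_sym_mats] subspace_scale[OF subspace_sym_mats] A_sym)

lemma comb_inner: "comb y \<bullet> X = (\<Sum>j\<in>UNIV. y $ j * (A j \<bullet> X))"
  by (simp add: comb_def inner_sum_left)

lemma linear_comb: "linear comb"
  by (rule linearI) (simp_all add: comb_def scaleR_add_left sum.distrib scaleR_sum_right)

lemma slack_sym: "- comb y + t *\<^sub>R C \<in> sym_mats"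
  by (intro subspace_add subspace_neg subspace_scale subspace_sym_mats comb_sym C_sym)

lemma slack_psd_iff: "psd (- comb y + t *\<^sub>R C) \<longleftrightarrow> (\<forall>X. psd X \<longrightarrow> comb y \<bullet> X \<le> t * (C \<bullet> X))"
  using dual_cone_psd_iff[OF slack_sym, of y t]
  by (simp add: dual_cone_def inner_add_left inner_diff_left)

lemma linear_le_comb_iff:
  "(\<forall>y. (\<forall>j. 0 \<le> y $ j) \<longrightarrow> y \<bullet> d \<le> comb y \<bullet> X) \<longleftrightarrow> (\<forall>i. d $ i \<le> A i \<bullet> X)"
proof
  assume L: "\<forall>y. (\<forall>j. 0 \<le> y $ j) \<longrightarrow> y \<bullet> d \<le> comb y \<bullet> X"
  show "\<forall>i. d $ i \<le> A i \<bullet> X"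
  proof
    fix i
    have "axis i 1 \<bullet> d \<le> comb (axis i 1) \<bullet> X" using L by (auto simp: axis_def)
    moreover have "comb (axis i 1) = A i"
      by (simp add: comb_def axis_def if_distrib[of "\<lambda>r. r *\<^sub>R _"] cong: if_cong)
    ultimately show "d $ i \<le> A i \<bullet> X" by (simp add: inner_axis')
  qed
next
  assume "\<forall>i. d $ i \<le> A i \<bullet> X"
  then show "\<forall>y. (\<forall>j. 0 \<le> y $ j) \<longrightarrow> y \<bullet> d \<le> comb y \<bullet> X"
    by (auto simp: comb_inner inner_real_vec intro!: sum_mono mult_left_mono)
qed

lemma P_feasible_iff: "X \<in> P_feasible A b \<longleftrightarrow> psd X \<and> (\<forall>i. b $ i \<le> A i \<bullet> X)"
  by (auto simp: P_feasible_def mat_inner_eq_inner A_sym)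

lemma D_feasible_iff:
  "y \<in> D_feasible A C \<longleftrightarrow> (\<forall>j. 0 \<le> y $ j) \<and> psd (- comb y + C)"
  by (auto simp: D_feasible_def comb_def)

text \<open>The primal semidefinite program is a conic program whose conic dual is the dual semidefinite program.\<close>
sublocale P: conic_program "{X. psd X}" "{y. \<forall>j. 0 \<le> y $ j}" "\<lambda>X. \<chi> i. A i \<bullet> X" C b "\<chi> i. 1"
proof (rule conic_program.intro)
  show "linear (\<lambda>X. \<chi> i. A i \<bullet> X)"
    by (rule linearI) (simp_all add: vec_eq_iff inner_add_right)
qed (auto simp: dual_cone_orthant inner_real_vec convex_cone_psd convex_cone_orthant
    intro: orthant_sum_pos)

text \<open>
  The dual semidefinite program, with negated objective, is a conic program too, and its conic dual is
  the primal semidefinite program. The identity matrix has inner product \<open>trace X\<close> with \<open>X\<close>.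
\<close>
sublocale D: conic_program "{y. \<forall>j. 0 \<le> y $ j}" "dual_cone {X. psd X}"
  "\<lambda>y. - comb y" "- b" "- C" "mat 1"
proof (rule conic_program.intro)
  show "linear (\<lambda>y. - comb y)" using linear_comb by (rule linear_compose_neg)
qed (auto simp: dual_cone_dual_cone_psd trace_psd_pos trace_eq_inner[symmetric]
    inner_commute[of _ "mat 1"] convex_cone_dual_cone convex_cone_orthant)

lemma inner_constraint_map: "(\<chi> i. A i \<bullet> X) \<bullet> y = comb y \<bullet> X"
  by (simp add: comb_inner inner_real_vec mult.commute)

lemma P_primal: "P.primal = P_feasible A b"
  by (auto simp: P.primal_def P_feasible_iff)

lemma P_dual: "P.dual = D_feasible A C"
  using slack_psd_iff[of _ 1]
  by (auto simp: P.dual_def D_feasible_iff dual_cone_orthant inner_constraint_map)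

lemma D_primal: "D.primal = D_feasible A C"
proof -
  have "- comb y - - C \<in> dual_cone {X. psd X} \<longleftrightarrow> psd (- comb y + C)" for y
    using dual_cone_psd_iff[OF slack_sym, of y 1] unfolding scaleR_one diff_minus_eq_add .
  then show ?thesis
    unfolding D.primal_def by (intro set_eqI) (simp only: mem_Collect_eq D_feasible_iff)
qed

lemma D_dual: "D.dual = P_feasible A b"
proof -
  have "X \<in> D.dual \<longleftrightarrow> psd X \<and> (\<forall>y. (\<forall>j. 0 \<le> y $ j) \<longrightarrow> y \<bullet> b \<le> comb y \<bullet> X)" for X
    by (simp add: D.dual_def dual_cone_dual_cone_psd inner_commute[of _ b])
  then show ?thesis by (auto simp only: linear_le_comb_iff P_feasible_iff)
qed

lemma P_strict_imp:
  assumes "psd X" and "(\<chi> i. A i \<bullet> X) - b \<in> P.strict"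
  shows "P_strictly_feasible A b"
proof -
  have "b $ i < A i \<bullet> X" for i
  proof -
    have "axis i 1 \<in> dual_cone {y :: real^'n. \<forall>j. 0 \<le> y $ j}"
      by (simp add: dual_cone_orthant axis_def)
    moreover have "axis i 1 \<noteq> (0 :: real^'n)" by (simp add: axis_eq_0_iff)
    ultimately have "0 < axis i 1 \<bullet> ((\<chi> i. A i \<bullet> X) - b)"
      using assms(2) unfolding P.strict_def by blast
    then show ?thesis by (simp add: inner_axis')
  qed
  then show ?thesis
    using assms(1) by (auto simp: P_strictly_feasible_def mat_inner_eq_inner A_sym)
qed

lemma D_strict_imp:
  assumes "\<forall>j. 0 \<le> y $ j" and "- comb y - - C \<in> D.strict"
  shows "D_strictly_feasible A C"
proof -
  have "0 < v \<bullet> ((- comb y + C) *v v)" if "v \<noteq> 0" for v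
  proof -
    have "v \<bullet> (outer v *v v) \<noteq> 0" using that by (simp add: outer_mult_vector)
    then have "outer v \<noteq> 0" by auto
    then have "0 < outer v \<bullet> (- comb y - - C)"
      using assms(2) psd_outer unfolding D.strict_def dual_cone_dual_cone_psd by blast
    then show ?thesis by (simp add: inner_commute inner_outer[symmetric])
  qed
  then have "pos_def (- comb y + C)" using slack_sym[of y 1] by (simp add: pos_def_def)
  then show ?thesis using assms(1) by (auto simp: D_strictly_feasible_def comb_def)
qed

text \<open>
  Feasible points of both programs force \<open>b \<bullet> y = 0 = C \<bullet> X\<close>, and a common positive factor
  achieves the normalisation.
\<close>
lemma recession_pair:
  assumes ne: "P_feasible A b \<noteq> {}" "D_feasible A C \<noteq> {}"
    and y: "\<forall>j. 0 \<le> y $ j" "y \<noteq> 0" "psd (- comb y)" "0 \<le> b \<bullet> y"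
    and X: "psd X" "X \<noteq> 0" "\<forall>i. 0 \<le> A i \<bullet> X" "C \<bullet> X \<le> 0"
  shows "\<exists>y X. homogenized_solution A b C y X 0 \<and> y \<noteq> 0 \<and> X \<noteq> 0 \<and> b \<bullet> y = C \<bullet>\<^sub>F X"
proof -
  obtain X0 y0 where X0: "X0 \<in> P_feasible A b" and y0: "y0 \<in> D_feasible A C" using ne by blast
  have "b \<bullet> y \<le> comb y \<bullet> X0"
    using X0 y(1) linear_le_comb_iff[of b X0] by (auto simp: P_feasible_iff inner_commute)
  also have "\<dots> \<le> 0" using slack_psd_iff[of y 0] y(3) X0 by (auto simp: P_feasible_iff)
  finally have by0: "b \<bullet> y = 0" using y(4) by simp
  have "0 \<le> comb y0 \<bullet> X"
    using X(3) y0 by (auto simp: D_feasible_iff comb_inner intro!: sum_nonneg)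
  also have "\<dots> \<le> C \<bullet> X" using slack_psd_iff[of y0 1] y0 X(1) by (auto simp: D_feasible_iff)
  finally have CX0: "C \<bullet> X = 0" using X(4) by simp
  define s where "s = 1 / ((\<Sum>j\<in>UNIV. y $ j) + trace X)"
  have pos: "0 < (\<Sum>j\<in>UNIV. y $ j) + trace X"
    using orthant_sum_pos[OF y(1,2)] trace_psd_pos[OF X(1,2)] by simp
  have s: "0 < s" using pos by (simp add: s_def)
  have "comb (s *\<^sub>R y) = s *\<^sub>R comb y" using linear_comb by (rule linear_scale)
  moreover have "psd (s *\<^sub>R (- comb y))" "psd (s *\<^sub>R X)"
    using convex_cone_scaleR[OF convex_cone_psd, of s] s y(3) X(1)
    by (simp_all del: scaleR_minus_right)
  ultimately have psd: "psd (- (\<Sum>j\<in>UNIV. (s *\<^sub>R y) $ j *\<^sub>R A j) + 0 *\<^sub>R C)" "psd (s *\<^sub>R X)"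
    unfolding comb_def by simp_all
  have "(\<Sum>j\<in>UNIV. (s *\<^sub>R y) $ j) + trace (s *\<^sub>R X) = s * ((\<Sum>j\<in>UNIV. y $ j) + trace X)"
    by (simp add: trace_eq_inner sum_distrib_left distrib_left)
  also have "\<dots> = 1" using pos by (simp add: s_def)
  finally have "homogenized_solution A b C (s *\<^sub>R y) (s *\<^sub>R X) 0"
    using psd s y X by0 CX0
    by (simp add: homogenized_solution_def mat_inner_eq_inner A_sym C_sym)
  moreover have "b \<bullet> (s *\<^sub>R y) = C \<bullet>\<^sub>F (s *\<^sub>R X)"
    using by0 CX0 by (simp add: mat_inner_eq_inner C_sym)
  ultimately show ?thesis using s y(2) X(2) by fastforce
qed

text \<open>The dual program has no nonzero recession direction along which its objective does not decrease.\<close>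
lemma P_strict_case:
  assumes ne: "P_feasible A b \<noteq> {}" "D_feasible A C \<noteq> {}"
    and none: "\<not> (\<exists>y. (\<forall>j. 0 \<le> y $ j) \<and> y \<noteq> 0 \<and> psd (- comb y) \<and> 0 \<le> b \<bullet> y)"
  shows "P_strictly_feasible A b" "P_val A b C = D_val A b C"
    "D_solutions A b C \<noteq> {}" "convex (D_solutions A b C)" "bounded (D_solutions A b C)"
proof -
  have "psd (- comb y)" if "\<forall>X. psd X \<longrightarrow> comb y \<bullet> X \<le> 0" for y
    using slack_psd_iff[of y 0] that by simp
  then have "\<forall>y\<in>dual_cone {y. \<forall>j. 0 \<le> y $ j}. y \<noteq> 0 \<longrightarrow>
      (\<forall>X\<in>{X. psd X}. (\<chi> i. A i \<bullet> X) \<bullet> y \<le> 0) \<longrightarrow> b \<bullet> y < 0"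
    using none unfolding dual_cone_orthant inner_constraint_map by (metis mem_Collect_eq not_le)
  from P.strictly_feasible[OF this] obtain X0
    where X0: "X0 \<in> {X. psd X}" "(\<chi> i. A i \<bullet> X0) - b \<in> P.strict" by blast
  then show "P_strictly_feasible A b" using P_strict_imp by simp
  have P: "P_val A b C = (INF X\<in>P.primal. ereal (C \<bullet> X))"
    by (simp add: P_val_def P_primal mat_inner_eq_inner C_sym)
  have D: "D_val A b C = (SUP y\<in>P.dual. ereal (b \<bullet> y))"
    by (simp add: D_val_def P_dual)
  have S: "D_solutions A b C = {y\<in>P.dual. ereal (b \<bullet> y) = (SUP y\<in>P.dual. ereal (b \<bullet> y))}"
    by (simp add: D_solutions_def P_dual D_val_def)
  note duality = P.strong_duality[OF ne[folded P_primal P_dual] X0]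
  show "P_val A b C = D_val A b C" unfolding P D by (rule duality)
  show "D_solutions A b C \<noteq> {}" "convex (D_solutions A b C)" "bounded (D_solutions A b C)"
    unfolding S by (rule duality)+
qed

text \<open>The primal program has no nonzero recession direction along which its objective does not increase.\<close>
lemma D_strict_case:
  assumes ne: "P_feasible A b \<noteq> {}" "D_feasible A C \<noteq> {}"
    and none: "\<not> (\<exists>X. psd X \<and> X \<noteq> 0 \<and> (\<forall>i. 0 \<le> A i \<bullet> X) \<and> C \<bullet> X \<le> 0)"
  shows "D_strictly_feasible A C" "P_val A b C = D_val A b C"
    "P_solutions A b C \<noteq> {}" "convex (P_solutions A b C)" "bounded (P_solutions A b C)"
proof -
  have "\<forall>i. 0 \<le> A i \<bullet> X" if "\<forall>y\<in>{y. \<forall>j. 0 \<le> y $ j}. - comb y \<bullet> X \<le> 0" for X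
    using linear_le_comb_iff[of 0 X] that by simp
  then have "\<forall>X\<in>dual_cone (dual_cone {X. psd X}). X \<noteq> 0 \<longrightarrow>
      (\<forall>y\<in>{y. \<forall>j. 0 \<le> y $ j}. - comb y \<bullet> X \<le> 0) \<longrightarrow> - C \<bullet> X < 0"
    using none unfolding dual_cone_dual_cone_psd
    by (metis inner_minus_left mem_Collect_eq neg_less_0_iff_less not_le)
  from D.strictly_feasible[OF this] obtain y0
    where y0: "y0 \<in> {y. \<forall>j. 0 \<le> y $ j}" "- comb y0 - - C \<in> D.strict" by blast
  then show "D_strictly_feasible A C" using D_strict_imp by blast
  have P: "P_val A b C = - (SUP X\<in>D.dual. ereal (- C \<bullet> X))"
    using ereal_INF_uminus_eq[of "\<lambda>X. ereal (- C \<bullet> X)" D.dual]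
    by (simp add: P_val_def D_dual mat_inner_eq_inner C_sym)
  have D: "D_val A b C = - (INF y\<in>D.primal. ereal (- b \<bullet> y))"
    using ereal_SUP_uminus_eq[of "\<lambda>y. ereal (- b \<bullet> y)" D.primal]
    by (simp add: D_val_def D_primal)
  have S: "P_solutions A b C =
      {X\<in>D.dual. ereal (- C \<bullet> X) = (SUP X\<in>D.dual. ereal (- C \<bullet> X))}"
  proof -
    have "ereal r = - v \<longleftrightarrow> ereal (- r) = v" for r v
      by (metis ereal_uminus_eq_reorder uminus_ereal.simps(1))
    then show ?thesis
      unfolding P_solutions_def P D_dual by (simp add: mat_inner_eq_inner C_sym)
  qed
  note duality = D.strong_duality[OF ne(2,1)[folded D_primal D_dual] y0]
  show "P_val A b C = D_val A b C" unfolding P D by (simp only: duality(1))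
  show "P_solutions A b C \<noteq> {}" "convex (P_solutions A b C)" "bounded (P_solutions A b C)"
    unfolding S by (rule duality)+
qed

end

theorem theorem4p2:
  fixes A :: "'n::finite \<Rightarrow> real^'m^'m" and C :: "real^'m^'m" and b :: "real^'n"
  assumes "\<forall>i. A i \<in> sym_mats" and "C \<in> sym_mats"
    and "P_feasible A b \<noteq> {}" and "D_feasible A C \<noteq> {}"
    and "\<not> (\<exists>y X t. homogenized_solution A b C y X t \<and>
                y \<noteq> 0 \<and> X \<noteq> 0 \<and> t = 0 \<and> b \<bullet> y = C \<bullet>\<^sub>F X)"
  shows "(P_strictly_feasible A b \<or> D_strictly_feasible A C) \<and>
         P_val A b C = D_val A b C \<and>
         ((P_solutions A b C \<noteq> {} \<and> convex (P_solutions A b C) \<and> bounded (P_solutions A b C)) \<or>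
          (D_solutions A b C \<noteq> {} \<and> convex (D_solutions A b C) \<and> bounded (D_solutions A b C)))"
proof -
  interpret semidefinite_program A C b
    using assms(1,2) by unfold_locales auto
  show ?thesis
  proof (cases "\<exists>y. (\<forall>j. 0 \<le> y $ j) \<and> y \<noteq> 0 \<and> psd (- comb y) \<and> 0 \<le> b \<bullet> y")
    case True
    then have "\<not> (\<exists>X. psd X \<and> X \<noteq> 0 \<and> (\<forall>i. 0 \<le> A i \<bullet> X) \<and> C \<bullet> X \<le> 0)"
      using recession_pair[OF assms(3,4)] assms(5) by blast
    from D_strict_case[OF assms(3,4) this] show ?thesis by blast
  next
    case False
    from P_strict_case[OF assms(3,4) this] show ?thesis by blast
  qed
qed

end
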